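(* Let $J$ be a complex structure on a $6$-dimensional $3$-step nilpotent Lie algebra $\mathfrak{g}$ admitting a basis $\{\omega^1,\omega^2,\omega^3\}$ of $\mathfrak{g}^{1,0}$ with $$d\omega^1=0,\qquad d\omega^2=\omega^{1\bar1},\qquad d\omega^3=\omega^{12}+B\,\omega^{1\bar 2}+c\,\omega^{2\bar 1},$$ where $B\in\mathbb{C}$, $c\in\mathbb{R}$, $c\ge0$, and $c=|B-1|\neq 0$. Then: (i) $\mathfrak{g}\cong\mathfrak{h}_{10}$ if and only if $B=0$; (ii) $\mathfrak{g}\cong\mathfrak{h}_{11}$ if and only if $B\in\mathbb{R}\setminus\{0,1\}$; (iii) $\mathfrak{g}\cong\mathfrak{h}_{12}$ if and only if $\operatorname{Im}B\neq 0$. In particular, all the complex structures on $\mathfrak{h}_{10}$ are equivalent.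
   Context: A complex structure on a real Lie algebra $\mathfrak{g}$ is an endomorphism $J$ with $J^2=-\mathrm{Id}$ and $[JX,JY]=J[JX,Y]+J[X,JY]+[X,Y]$ for all $X,Y$. $\mathfrak{g}^{1,0}\subset\mathfrak{g}_{\mathbb{C}}^*$ is the $i$-eigenspace of $J$ acting on $\mathfrak{g}_{\mathbb{C}}^*$; $d$ is the Chevalley–Eilenberg differential. Notation: $\omega^{jk}=\omega^j\wedge\omega^k$, $\omega^{j\bar k}=\omega^j\wedge\overline{\omega^k}$. Two complex structures $J,J'$ on $\mathfrak{g}$ are equivalent if $J'=F^{-1}\circ J\circ F$ for some Lie algebra automorphism $F$ of $\mathfrak{g}$. The real Lie algebras are described by the differentials of a basis $e^1,\dots,e^6$ of the dual, with $ij$ denoting $e^i\wedge e^j$ (the $k$-th entry is $de^k$): $\mathfrak{h}_{10}=(0,0,0,12,13,14)$, $\mathfrak{h}_{11}=(0,0,0,12,13,14+23)$, $\mathfrak{h}_{12}=(0,0,0,12,13,24)$. *)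

theory Defs
  imports "HOL-Analysis.Analysis" "HOL-Library.Function_Algebras"
begin

locale real_lie_algebra =
  fixes br :: "'g::real_vector \<Rightarrow> 'g \<Rightarrow> 'g"
  assumes bilinear: "bilinear br"
    and alternating: "br X X = 0"
    and jacobi: "br X (br Y Z) + br Y (br Z X) + br Z (br X Y) = 0"

definition lie_iso ::
  "('g::real_vector \<Rightarrow> 'g \<Rightarrow> 'g) \<Rightarrow> ('h::real_vector \<Rightarrow> 'h \<Rightarrow> 'h) \<Rightarrow> ('g \<Rightarrow> 'h) \<Rightarrow> bool" where
  "lie_iso br br' F \<longleftrightarrow>
     linear F \<and> bij F \<and> (\<forall>X Y. F (br X Y) = br' (F X) (F Y))"

definition lie_isomorphic ::
  "('g::real_vector \<Rightarrow> 'g \<Rightarrow> 'g) \<Rightarrow> ('h::real_vector \<Rightarrow> 'h \<Rightarrow> 'h) \<Rightarrow> bool" where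
  "lie_isomorphic br br' \<longleftrightarrow> (\<exists>F. lie_iso br br' F)"

fun lower_central :: "('g::real_vector \<Rightarrow> 'g \<Rightarrow> 'g) \<Rightarrow> nat \<Rightarrow> 'g set" where
  "lower_central br 0 = UNIV"
| "lower_central br (Suc k) = span {br X Y | X Y. X \<in> lower_central br k}"

definition step_nilpotent :: "nat \<Rightarrow> ('g::real_vector \<Rightarrow> 'g \<Rightarrow> 'g) \<Rightarrow> bool" where
  "step_nilpotent s br \<longleftrightarrow>
     lower_central br s = {0} \<and> (\<forall>k<s. lower_central br k \<noteq> {0})"

text \<open>
  The differential of a 1-form and the wedge of two 1-forms are given by their values on
  the (real) Lie algebra.  The value type is \<^typ>\<open>real\<close> for forms in the dual and
  \<^typ>\<open>complex\<close> for forms in the complexified dual (see below); a complex form on the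
  complexified Lie algebra is determined by its values on real vectors.
\<close>

definition ce_d :: "('g \<Rightarrow> 'g \<Rightarrow> 'g) \<Rightarrow> ('g \<Rightarrow> 'k::ab_group_add) \<Rightarrow> 'g \<Rightarrow> 'g \<Rightarrow> 'k" where
  "ce_d br \<alpha> X Y = - \<alpha> (br X Y)"

definition wedge :: "('g \<Rightarrow> 'k::comm_ring) \<Rightarrow> ('g \<Rightarrow> 'k) \<Rightarrow> 'g \<Rightarrow> 'g \<Rightarrow> 'k"
    (infixl \<open>\<and>\<^sub>w\<close> 70) where
  "(\<alpha> \<and>\<^sub>w \<beta>) X Y = \<alpha> X * \<beta> Y - \<alpha> Y * \<beta> X"

text \<open>
  The complexification of the dual is identified with the complex vector space of
  real-linear maps into the complex numbers: the form \<open>\<alpha> + i \<beta>\<close>, for real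
  \<open>\<alpha>\<close> and \<open>\<beta>\<close>, is the map sending \<open>X\<close> to
  \<open>\<alpha> X + i \<beta> X\<close>.  Complex conjugation of forms is pointwise.
\<close>

definition cdual :: "('g::real_vector \<Rightarrow> complex) set" where
  "cdual = {\<alpha>. linear \<alpha>}"

definition cform_scale :: "complex \<Rightarrow> ('g \<Rightarrow> complex) \<Rightarrow> 'g \<Rightarrow> complex" where
  "cform_scale z \<alpha> = (\<lambda>X. z * \<alpha> X)"

definition cform_cnj :: "('g \<Rightarrow> complex) \<Rightarrow> 'g \<Rightarrow> complex" where
  "cform_cnj \<alpha> = (\<lambda>X. cnj (\<alpha> X))"

global_interpretation cform: vector_space "cform_scale :: complex \<Rightarrow> ('g \<Rightarrow> complex) \<Rightarrow> 'g \<Rightarrow> complex"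
  by unfold_locales (auto simp: cform_scale_def fun_eq_iff algebra_simps)

definition complex_structure ::
  "('g::real_vector \<Rightarrow> 'g \<Rightarrow> 'g) \<Rightarrow> ('g \<Rightarrow> 'g) \<Rightarrow> bool" where
  "complex_structure br J \<longleftrightarrow>
     linear J \<and> (\<forall>X. J (J X) = - X) \<and>
     (\<forall>X Y. br (J X) (J Y) = J (br (J X) Y) + J (br X (J Y)) + br X Y)"

definition equivalent_complex_structures ::
  "('g::real_vector \<Rightarrow> 'g \<Rightarrow> 'g) \<Rightarrow> ('g \<Rightarrow> 'g) \<Rightarrow> ('g \<Rightarrow> 'g) \<Rightarrow> bool" where
  "equivalent_complex_structures br J J' \<longleftrightarrow>
     (\<exists>F. lie_iso br br F \<and> J' = inv F \<circ> J \<circ> F)"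

text \<open>
  The complex structure acts on forms by the transpose, \<open>J \<alpha> = \<alpha> \<circ> J\<close>;
  the forms of type (1,0) are the eigenforms for the eigenvalue \<open>i\<close>.
\<close>

definition forms10 :: "('g::real_vector \<Rightarrow> 'g) \<Rightarrow> ('g \<Rightarrow> complex) set" where
  "forms10 J = {\<alpha> \<in> cdual. \<alpha> \<circ> J = cform_scale \<i> \<alpha>}"

definition basis10 ::
  "('g::real_vector \<Rightarrow> 'g) \<Rightarrow> ('g \<Rightarrow> complex) \<Rightarrow> ('g \<Rightarrow> complex) \<Rightarrow> ('g \<Rightarrow> complex) \<Rightarrow> bool" where
  "basis10 J \<omega>\<^sub>1 \<omega>\<^sub>2 \<omega>\<^sub>3 \<longleftrightarrow>
     distinct [\<omega>\<^sub>1, \<omega>\<^sub>2, \<omega>\<^sub>3] \<and>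
     cform.independent {\<omega>\<^sub>1, \<omega>\<^sub>2, \<omega>\<^sub>3} \<and>
     cform.span {\<omega>\<^sub>1, \<omega>\<^sub>2, \<omega>\<^sub>3} = forms10 J"

definition coord :: "6 \<Rightarrow> real ^ 6 \<Rightarrow> real" where
  "coord k X = X $ k"

definition e2 :: "6 \<Rightarrow> 6 \<Rightarrow> real ^ 6 \<Rightarrow> real ^ 6 \<Rightarrow> real" where
  "e2 i j = coord i \<and>\<^sub>w coord j"

text \<open>
  The bracket on \<^typ>\<open>real ^ 6\<close> for which the coordinate forms \<open>e\<^sup>1, \<dots>, e\<^sup>6\<close> have
  prescribed differentials: \<open>de\<^sup>k (X, Y) = - e\<^sup>k [X, Y]\<close>, so the \<open>k\<close>-th
  coordinate of \<open>[X, Y]\<close> is \<open>- de\<^sup>k (X, Y)\<close>.  In the index type the numeral 6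
  denotes the same element as 0.
\<close>

definition bracket_of_differentials ::
  "(6 \<Rightarrow> real ^ 6 \<Rightarrow> real ^ 6 \<Rightarrow> real) \<Rightarrow> real ^ 6 \<Rightarrow> real ^ 6 \<Rightarrow> real ^ 6" where
  "bracket_of_differentials \<theta> X Y = (\<chi> k. - \<theta> k X Y)"

definition h10 :: "real ^ 6 \<Rightarrow> real ^ 6 \<Rightarrow> real ^ 6" where
  "h10 = bracket_of_differentials ((\<lambda>_. 0)(4 := e2 1 2, 5 := e2 1 3, 6 := e2 1 4))"

definition h11 :: "real ^ 6 \<Rightarrow> real ^ 6 \<Rightarrow> real ^ 6" where
  "h11 = bracket_of_differentials ((\<lambda>_. 0)(4 := e2 1 2, 5 := e2 1 3, 6 := e2 1 4 + e2 2 3))"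

definition h12 :: "real ^ 6 \<Rightarrow> real ^ 6 \<Rightarrow> real ^ 6" where
  "h12 = bracket_of_differentials ((\<lambda>_. 0)(4 := e2 1 2, 5 := e2 1 3, 6 := e2 2 4))"

lemma ce_d_bracket_of_differentials:
  "ce_d (bracket_of_differentials \<theta>) (coord k) = \<theta> k"
  by (simp add: fun_eq_iff ce_d_def coord_def bracket_of_differentials_def)

lemmas h_defs = h10_def h11_def h12_def bracket_of_differentials_def e2_def coord_def wedge_def

lemma real_lie_algebra_h10: "real_lie_algebra h10"
  and real_lie_algebra_h11: "real_lie_algebra h11"
  and real_lie_algebra_h12: "real_lie_algebra h12"
  by (unfold_locales;
      simp add: bilinear_def linear_iff h_defs vec_eq_iff fun_upd_apply algebra_simps)+

end

theory Submission
  imports Defs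
begin

text \<open>
  Write \<open>B = 1 - c u\<^sup>2\<close> with \<open>|u| = 1\<close>.  Rotating the third form of the
  basis by \<open>cnj u\<close> and the first by \<open>u\<close>, and passing to real and imaginary parts, gives
  a real normal form of the Lie algebra depending on \<open>cnj u\<^sup>2 = \<alpha> + i \<beta>\<close> and \<open>c\<close>,
  in which the three cases are matched with the three models by linear changes of coordinates.
  The models are told apart by the centralizer \<open>C\<close> of the derived algebra: it is abelian for the
  first, has brackets in \<open>[g, [g, g]]\<close> for the first two, and violates this for the third.

  The first model is \<open>\<real> e \<oplus> A\<close> with an abelian ideal \<open>A\<close>.  For a complex
  structure \<open>J\<close> on it choose \<open>v \<in> A\<close> with \<open>J v \<in> e + A\<close>.  Integrability
  makes \<open>ad (J v)\<close> commute with \<open>J\<close> on \<open>A \<inter> J A\<close>, so with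
  \<open>w = [J v, v]\<close> and \<open>y = [J v, w]\<close> both the bracket and \<open>J\<close> are completely
  determined on the basis \<open>v, J v, w, J w, y, J y\<close>.
\<close>

section \<open>Coordinates on \<open>real ^ 6\<close> and the brackets of the three models\<close>

lemma forall_6: "(\<forall>k::6. P k) \<longleftrightarrow> P 1 \<and> P 2 \<and> P 3 \<and> P 4 \<and> P 5 \<and> P 6"
proof -
  have "(UNIV :: 6 set) = {1, 2, 3, 4, 5, 6}"
    by (rule card_subset_eq[symmetric]) auto
  then show ?thesis
    by (metis UNIV_I insertE empty_iff)
qed

definition vec6 :: "real \<Rightarrow> real \<Rightarrow> real \<Rightarrow> real \<Rightarrow> real \<Rightarrow> real \<Rightarrow> real ^ 6" where
  "vec6 a b c d e f = (\<chi> k. ((\<lambda>_. 0)(1 := a, 2 := b, 3 := c, 4 := d, 5 := e, 6 := f)) k)"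

lemma vec6_nth [simp]:
  "vec6 a b c d e f $ 1 = a" "vec6 a b c d e f $ 2 = b" "vec6 a b c d e f $ 3 = c"
  "vec6 a b c d e f $ 4 = d" "vec6 a b c d e f $ 5 = e" "vec6 a b c d e f $ 6 = f"
  by (simp_all add: vec6_def)

lemma vec6_eq_iff:
  fixes X Y :: "real ^ 6"
  shows "X = Y \<longleftrightarrow> X $ 1 = Y $ 1 \<and> X $ 2 = Y $ 2 \<and> X $ 3 = Y $ 3 \<and>
    X $ 4 = Y $ 4 \<and> X $ 5 = Y $ 5 \<and> X $ 6 = Y $ 6"
  by (simp add: vec_eq_iff forall_6)

lemma h10_eq: "h10 X Y = vec6 0 0 0 (X $ 2 * Y $ 1 - X $ 1 * Y $ 2)
    (X $ 3 * Y $ 1 - X $ 1 * Y $ 3) (X $ 4 * Y $ 1 - X $ 1 * Y $ 4)"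
  by (simp add: vec6_eq_iff h_defs algebra_simps)

lemma h11_eq: "h11 X Y = vec6 0 0 0 (X $ 2 * Y $ 1 - X $ 1 * Y $ 2)
    (X $ 3 * Y $ 1 - X $ 1 * Y $ 3)
    (X $ 4 * Y $ 1 - X $ 1 * Y $ 4 + X $ 3 * Y $ 2 - X $ 2 * Y $ 3)"
  by (simp add: vec6_eq_iff h_defs algebra_simps)

lemma h12_eq: "h12 X Y = vec6 0 0 0 (X $ 2 * Y $ 1 - X $ 1 * Y $ 2)
    (X $ 3 * Y $ 1 - X $ 1 * Y $ 3) (X $ 4 * Y $ 2 - X $ 2 * Y $ 4)"
  by (simp add: vec6_eq_iff h_defs algebra_simps)

section \<open>Isomorphisms of Lie algebras\<close>

lemma lie_isomorphic_sym:
  assumes "lie_isomorphic br br'"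
  shows "lie_isomorphic br' br"
proof -
  obtain F where F: "linear F" "bij F" "\<And>X Y. F (br X Y) = br' (F X) (F Y)"
    using assms by (auto simp: lie_isomorphic_def lie_iso_def)
  obtain G where G: "linear G" "G \<circ> F = id"
    using linear_injective_left_inverse[OF F(1) bij_is_inj[OF F(2)]] by blast
  have GF: "G (F X) = X" for X
    using G(2) by (simp add: fun_eq_iff)
  have FG: "F (G Y) = Y" for Y
    using GF F(2) by (metis bij_pointE)
  have "bij G"
    by (rule o_bij[where g = F]) (auto simp: GF FG)
  moreover have "G (br' X Y) = br (G X) (G Y)" for X Y
    by (metis F(3) FG GF)
  ultimately show ?thesis
    using G(1) by (auto simp: lie_isomorphic_def lie_iso_def)
qed

lemma lie_iso_comp:
  "lie_iso br br' F \<Longrightarrow> lie_iso br' br'' G \<Longrightarrow> lie_iso br br'' (G \<circ> F)"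
  by (auto simp: lie_iso_def linear_compose bij_comp)

lemma lie_isomorphic_trans:
  "lie_isomorphic br br' \<Longrightarrow> lie_isomorphic br' br'' \<Longrightarrow> lie_isomorphic br br''"
  unfolding lie_isomorphic_def by (blast intro: lie_iso_comp)

text \<open>The image of a basis of the domain is independent with \<open>DIM('h)\<close> elements,
  hence spans the codomain. The domain is a bare real vector space, so its dimension enters through
  a basis.\<close>

lemma linear_injective_bij:
  fixes F :: "'g::real_vector \<Rightarrow> 'h::euclidean_space"
  assumes dim: "dim (UNIV :: 'g set) = DIM('h)"
    and F: "linear F" and ker: "\<And>X. F X = 0 \<Longrightarrow> X = 0"
  shows "bij F"
proof -
  have inj: "inj F"
    using F ker by (simp add: linear_injective_0)
  obtain b :: "'g set" where b: "independent b" "card b = DIM('h)"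
    using basis_exists[of "UNIV :: 'g set"] dim by metis
  have "independent (F ` b)"
    using b(1) F inj by (simp add: linear_independent_injective_image inj_on_subset)
  moreover have "card (F ` b) = DIM('h)"
    using b(2) inj by (simp add: card_image inj_on_subset)
  ultimately have "UNIV \<subseteq> span (F ` b)"
    by (intro card_ge_dim_independent) auto
  also have "\<dots> = F ` span b"
    using F by (simp add: linear_span_image)
  finally have "surj F" by blast
  with inj show ?thesis by (simp add: bij_def)
qed

lemma lie_isomorphicI:
  fixes F :: "'g::real_vector \<Rightarrow> 'h::euclidean_space"
  assumes "dim (UNIV :: 'g set) = DIM('h)" "linear F" "\<And>X. F X = 0 \<Longrightarrow> X = 0"
    "\<And>X Y. F (br X Y) = br' (F X) (F Y)"
  shows "lie_isomorphic br br'"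
  using linear_injective_bij[OF assms(1-3)] assms
  by (auto simp: lie_isomorphic_def lie_iso_def)

section \<open>Invariants separating the models\<close>

definition centralizes_derived :: "('g::real_vector \<Rightarrow> 'g \<Rightarrow> 'g) \<Rightarrow> 'g \<Rightarrow> bool" where
  "centralizes_derived br X \<longleftrightarrow> (\<forall>U V. br X (br U V) = 0)"

definition abelian_centralizer :: "('g::real_vector \<Rightarrow> 'g \<Rightarrow> 'g) \<Rightarrow> bool" where
  "abelian_centralizer br \<longleftrightarrow>
     (\<forall>X Y. centralizes_derived br X \<longrightarrow> centralizes_derived br Y \<longrightarrow> br X Y = 0)"

text \<open>A single double bracket is asked for instead of a sum of them: this holds for
  \<open>h11\<close> and transfers along isomorphisms directly.\<close>

definition centralizer_brackets_double :: "('g::real_vector \<Rightarrow> 'g \<Rightarrow> 'g) \<Rightarrow> bool" where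
  "centralizer_brackets_double br \<longleftrightarrow>
     (\<forall>X Y. centralizes_derived br X \<longrightarrow> centralizes_derived br Y \<longrightarrow>
        (\<exists>U V W. br X Y = br U (br V W)))"

lemma centralizes_derived_iso:
  assumes "lie_iso br br' F"
  shows "centralizes_derived br' (F X) \<longleftrightarrow> centralizes_derived br X"
proof -
  have F: "linear F" "inj F" "surj F" "\<And>X Y. F (br X Y) = br' (F X) (F Y)"
    using assms by (auto simp: lie_iso_def bij_def)
  have "br' (F X) (br' (F U) (F V)) = 0 \<longleftrightarrow> br X (br U V) = 0" for U V
    using F by (metis linear_injective_0 linear_0)
  then show ?thesis
    unfolding centralizes_derived_def using F(3) by (metis surjD)
qed

lemma abelian_centralizer_iso:
  assumes "lie_isomorphic br br'" "abelian_centralizer br"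
  shows "abelian_centralizer br'"
proof -
  obtain F where F: "lie_iso br br' F"
    using assms(1) by (auto simp: lie_isomorphic_def)
  then have "linear F" "surj F" "\<And>X Y. F (br X Y) = br' (F X) (F Y)"
    by (auto simp: lie_iso_def bij_def)
  with assms(2) show ?thesis
    unfolding abelian_centralizer_def
    by (metis centralizes_derived_iso[OF F] surjD linear_0)
qed

lemma centralizer_brackets_double_iso:
  assumes "lie_isomorphic br br'" "centralizer_brackets_double br"
  shows "centralizer_brackets_double br'"
proof -
  obtain F where F: "lie_iso br br' F"
    using assms(1) by (auto simp: lie_isomorphic_def)
  then have "linear F" "surj F" "\<And>X Y. F (br X Y) = br' (F X) (F Y)"
    by (auto simp: lie_iso_def bij_def)
  with assms(2) show ?thesis
    unfolding centralizer_brackets_double_def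
    by (metis centralizes_derived_iso[OF F] surjD)
qed

lemma centralizes_derived_h10: "centralizes_derived h10 X \<Longrightarrow> X $ 1 = 0"
  unfolding centralizes_derived_def
  by (drule spec[of _ "vec6 1 0 0 0 0 0"], drule spec[of _ "vec6 0 1 0 0 0 0"])
     (simp add: h10_eq vec6_eq_iff)

lemma centralizes_derived_h11: "centralizes_derived h11 X \<longleftrightarrow> X $ 1 = 0"
proof
  assume "centralizes_derived h11 X"
  then have "h11 X (h11 (vec6 1 0 0 0 0 0) (vec6 0 1 0 0 0 0)) = 0"
    by (simp add: centralizes_derived_def)
  then show "X $ 1 = 0"
    by (simp add: h11_eq vec6_eq_iff)
qed (simp add: centralizes_derived_def h11_eq vec6_eq_iff)

lemma abelian_centralizer_h10: "abelian_centralizer h10"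
  unfolding abelian_centralizer_def
  by (auto dest!: centralizes_derived_h10 simp: h10_eq vec6_eq_iff)

lemma not_abelian_centralizer_h11: "\<not> abelian_centralizer h11"
proof
  assume "abelian_centralizer h11"
  then have "h11 (vec6 0 1 0 0 0 0) (vec6 0 0 1 0 0 0) = 0"
    by (simp add: abelian_centralizer_def centralizes_derived_h11)
  then show False
    by (simp add: h11_eq vec6_eq_iff)
qed

lemma centralizer_brackets_double_h11: "centralizer_brackets_double h11"
  unfolding centralizer_brackets_double_def centralizes_derived_h11
proof (intro allI impI)
  fix X Y :: "real ^ 6"
  assume "X $ 1 = 0" "Y $ 1 = 0"
  \<comment> \<open>Both sides lie on the sixth axis; the square of the adjoint map of the first
    basis vector takes the second to the sixth.\<close>
  then have "h11 X Y = h11 (vec6 1 0 0 0 0 0) (h11 (vec6 1 0 0 0 0 0)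
      (vec6 0 (X $ 3 * Y $ 2 - X $ 2 * Y $ 3) 0 0 0 0))"
    by (simp add: h11_eq vec6_eq_iff)
  then show "\<exists>U V W. h11 X Y = h11 U (h11 V W)" by blast
qed

text \<open>The first and third basis vectors centralize the derived algebra and their bracket is
  minus the fifth, whereas every double bracket is a multiple of the sixth.\<close>

lemma not_centralizer_brackets_double_h12: "\<not> centralizer_brackets_double h12"
proof
  assume *: "centralizer_brackets_double h12"
  have "centralizes_derived h12 (vec6 1 0 0 0 0 0)" "centralizes_derived h12 (vec6 0 0 1 0 0 0)"
    by (simp_all add: centralizes_derived_def h12_eq vec6_eq_iff)
  then obtain U V W where
    "h12 (vec6 1 0 0 0 0 0) (vec6 0 0 1 0 0 0) = h12 U (h12 V W)"
    using * unfolding centralizer_brackets_double_def by blast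
  then show False
    by (simp add: h12_eq vec6_eq_iff)
qed

text \<open>Zero is the double bracket \<open>br U (br V W)\<close> with
  \<open>U = br V W\<close>.\<close>

lemma abelian_imp_centralizer_brackets_double:
  assumes "real_lie_algebra br" "abelian_centralizer br"
  shows "centralizer_brackets_double br"
  using assms unfolding abelian_centralizer_def centralizer_brackets_double_def
  by (metis real_lie_algebra.alternating)

lemma not_isomorphic_h10_h11: "\<not> lie_isomorphic h10 h11"
  and not_isomorphic_h10_h12: "\<not> lie_isomorphic h10 h12"
  and not_isomorphic_h11_h12: "\<not> lie_isomorphic h11 h12"
  using abelian_centralizer_iso abelian_centralizer_h10 not_abelian_centralizer_h11
    centralizer_brackets_double_iso centralizer_brackets_double_h11 not_centralizer_brackets_double_h12
    abelian_imp_centralizer_brackets_double[OF real_lie_algebra_h10]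
  by blast+

section \<open>The real normal form and its isomorphisms with the models\<close>

text \<open>
  The coordinates are those of \<open>u \<omega>\<^sub>1 = x\<^sub>1 + i x\<^sub>2\<close>, \<open>\<omega>\<^sub>2 = x\<^sub>3 + i x\<^sub>4\<close>
  and \<open>cnj u \<omega>\<^sub>3 = x\<^sub>6 + i x\<^sub>5\<close> (real and imaginary parts swapped in the last pair).
\<close>

definition normal_bracket :: "real \<Rightarrow> real \<Rightarrow> real \<Rightarrow> real ^ 6 \<Rightarrow> real ^ 6 \<Rightarrow> real ^ 6" where
  "normal_bracket \<alpha> \<beta> c = bracket_of_differentials (\<lambda>k X Y. ((\<lambda>_. 0)
     (4 := - 2 * e2 1 2 X Y,
      5 := 2 * (\<beta> * e2 1 3 X Y + \<alpha> * e2 2 3 X Y),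
      6 := 2 * ((\<alpha> - c) * e2 1 3 X Y - \<beta> * e2 2 3 X Y - c * e2 2 4 X Y))) k)"

lemma normal_bracket_eq: "normal_bracket \<alpha> \<beta> c X Y = vec6 0 0 0
    (2 * (X $ 1 * Y $ 2 - Y $ 1 * X $ 2))
    (- 2 * (\<beta> * (X $ 1 * Y $ 3 - Y $ 1 * X $ 3) + \<alpha> * (X $ 2 * Y $ 3 - Y $ 2 * X $ 3)))
    (- 2 * ((\<alpha> - c) * (X $ 1 * Y $ 3 - Y $ 1 * X $ 3) - \<beta> * (X $ 2 * Y $ 3 - Y $ 2 * X $ 3)
      - c * (X $ 2 * Y $ 4 - Y $ 2 * X $ 4)))"
  by (simp add: vec6_eq_iff normal_bracket_def bracket_of_differentials_def e2_def wedge_def coord_def)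

text \<open>For these parameters the nonzero differentials are -2 e12, 2 e23 and -2 e24, all
  divisible by e2, which therefore takes the place of the first form of \<open>h10\<close>.\<close>

lemma normal_bracket_iso_h10: "lie_isomorphic (normal_bracket 1 0 1) h10"
  by (rule lie_isomorphicI[where F = "\<lambda>X. vec6 (2 * X $ 2) (X $ 1) (X $ 3) (X $ 4) (X $ 5) (- X $ 6)"])
     (auto simp: linear_iff vec6_eq_iff normal_bracket_eq h10_eq algebra_simps)

lemma normal_bracket_iso_h11:
  assumes "\<alpha> \<noteq> 0" "c \<noteq> 0" "\<alpha> \<noteq> c"
  shows "lie_isomorphic (normal_bracket \<alpha> 0 c) h11"
proof -
  \<comment> \<open>Again e2 and e1 become the first two forms. The factor \<open>k\<close> turns
    the e13 term in the differential of the sixth form into the term 23 of \<open>h11\<close>; it is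
    nonzero because \<alpha> differs from c.\<close>
  define k where "k = 2 * (\<alpha> - c) / c"
  show ?thesis
    by (rule lie_isomorphicI[where F = "\<lambda>X. vec6 (2 * X $ 2) (X $ 1) (- k * X $ 3) (X $ 4)
          (- k / \<alpha> * X $ 5) (- X $ 6 / c)"])
       (use assms in \<open>auto simp: k_def linear_iff vec6_eq_iff normal_bracket_eq h11_eq field_simps\<close>)
qed

lemma normal_bracket_iso_h12:
  assumes "\<alpha>\<^sup>2 + \<beta>\<^sup>2 = 1" "\<beta> \<noteq> 0" "c \<noteq> 0"
  shows "lie_isomorphic (normal_bracket \<alpha> \<beta> c) h12"
proof -
  \<comment> \<open>Comparing differentials under \<open>F\<close> forces the constants:
    \<open>l\<close> removes e13 from the sixth, \<open>k\<close> absorbs its e23 term into the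
    fourth form, and \<open>m\<close> adjusts the e13 term of the fifth.\<close>
  define k where "k = - 2 * (1 - \<alpha> * c) / \<beta>"
  have k: "k * \<beta> = - 2 * (\<alpha>\<^sup>2 + \<beta>\<^sup>2 - \<alpha> * c)"
    using assms by (simp add: k_def)
  define l where "l = (\<alpha> - c) / \<beta>"
  have l: "l * \<beta> = \<alpha> - c"
    using assms by (simp add: l_def)
  define m where "m = 4 * c / \<beta>"
  have m: "m * \<beta> = 4 * c" "m \<noteq> 0"
    using assms by (simp_all add: m_def)
  \<comment> \<open>This is the value of \<open>k\<close> that matches e23; it agrees with the
    definition because of \<alpha>^2 + \<beta>^2 = 1.\<close>
  have kl: "k = - 2 * \<beta> - 2 * \<alpha> * l"
  proof -
    have "\<beta> * k = \<beta> * (- 2 * \<beta> - 2 * \<alpha> * l)"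
      using k l by (simp add: algebra_simps power2_eq_square) algebra
    with assms show ?thesis by simp
  qed
  define F :: "real ^ 6 \<Rightarrow> real ^ 6" where "F = (\<lambda>X. vec6 (4 * c * X $ 1 + m * \<alpha> * X $ 2) (X $ 2) (X $ 3)
     (- 2 * c * X $ 4 + k * X $ 3) (m / 2 * X $ 5) (X $ 6 - l * X $ 5))"
  show ?thesis
  proof (rule lie_isomorphicI[where F = F])
    show "linear F"
      by (auto simp: F_def linear_iff vec6_eq_iff algebra_simps)
    show "X = 0" if "F X = 0" for X
      using that assms m by (auto simp: F_def vec6_eq_iff)
    show "F (normal_bracket \<alpha> \<beta> c X Y) = h12 (F X) (F Y)" for X Y
      unfolding F_def vec6_eq_iff normal_bracket_eq h12_eq
      using kl l m(1) by simp (intro conjI, algebra+)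
  qed simp
qed

section \<open>From a basis of (1,0)-forms to the normal form\<close>

lemma linear_separates:
  fixes X :: "'g::real_vector"
  assumes "\<And>f :: 'g \<Rightarrow> real. linear f \<Longrightarrow> f X = 0"
  shows "X = 0"
proof (rule ccontr)
  assume "X \<noteq> 0"
  then obtain f :: "'g \<Rightarrow> real" where "linear f" "f X = 1"
    using linear_independent_extend[of "{X}" "\<lambda>_. 1 :: real"] by auto
  with assms show False by fastforce
qed

lemma basis10_mem:
  assumes "basis10 J \<omega>\<^sub>1 \<omega>\<^sub>2 \<omega>\<^sub>3" "\<omega> \<in> {\<omega>\<^sub>1, \<omega>\<^sub>2, \<omega>\<^sub>3}"
  shows "linear \<omega>"
  using assms cform.span_base[of \<omega> "{\<omega>\<^sub>1, \<omega>\<^sub>2, \<omega>\<^sub>3}"]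
  by (auto simp: basis10_def forms10_def cdual_def)

text \<open>Every real functional f is the real part of the (1,0)-form f - i (f o J), which vanishes
  wherever the basis does; hence all functionals vanish at \<open>X\<close>.\<close>

lemma basis10_ker:
  assumes b: "basis10 J \<omega>\<^sub>1 \<omega>\<^sub>2 \<omega>\<^sub>3" and J: "linear J" "\<And>X. J (J X) = - X"
    and X: "\<omega>\<^sub>1 X = 0" "\<omega>\<^sub>2 X = 0" "\<omega>\<^sub>3 X = 0"
  shows "X = 0"
proof (rule linear_separates)
  fix f :: "'a \<Rightarrow> real"
  assume f: "linear f"
  define \<alpha> where "\<alpha> = (\<lambda>Y. Complex (f Y) (- f (J Y)))"
  have "linear \<alpha>"
    using f J(1) by (auto simp: \<alpha>_def linear_iff complex_eq_iff)
  moreover have "\<alpha> \<circ> J = cform_scale \<i> \<alpha>"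
    using f J(2) by (auto simp: \<alpha>_def cform_scale_def fun_eq_iff complex_eq_iff linear_neg)
  ultimately have "\<alpha> \<in> cform.span {\<omega>\<^sub>1, \<omega>\<^sub>2, \<omega>\<^sub>3}"
    using b by (auto simp: basis10_def forms10_def cdual_def)
  then have "\<alpha> X = 0"
  proof (induction rule: cform.span_induct)
    show "cform.subspace {\<alpha>. \<alpha> X = 0}"
      by (auto simp: cform.subspace_def cform_scale_def)
  qed (use X in auto)
  then show "f X = 0"
    by (simp add: \<alpha>_def complex_eq_iff)
qed

text \<open>Since u has modulus 1, the rotation leaves the shape of the second equation unchanged
  and turns the three coefficients of the last one into \<open>(cnj u)\<^sup>2\<close>,
  \<open>(cnj u)\<^sup>2 - c\<close> and \<open>c\<close>.\<close>

lemma isomorphic_normal_bracket: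
  fixes br :: "'g::real_vector \<Rightarrow> 'g \<Rightarrow> 'g"
  assumes dim: "dim (UNIV :: 'g set) = 6"
    and lin: "linear \<omega>\<^sub>1" "linear \<omega>\<^sub>2" "linear \<omega>\<^sub>3"
    and ker: "\<And>X. \<omega>\<^sub>1 X = 0 \<Longrightarrow> \<omega>\<^sub>2 X = 0 \<Longrightarrow> \<omega>\<^sub>3 X = 0 \<Longrightarrow> X = 0"
    and d1: "\<And>X Y. ce_d br \<omega>\<^sub>1 X Y = 0"
    and d2: "\<And>X Y. ce_d br \<omega>\<^sub>2 X Y = (\<omega>\<^sub>1 \<and>\<^sub>w cform_cnj \<omega>\<^sub>1) X Y"
    and d3: "\<And>X Y. ce_d br \<omega>\<^sub>3 X Y =
           (\<omega>\<^sub>1 \<and>\<^sub>w \<omega>\<^sub>2) X Y + B * (\<omega>\<^sub>1 \<and>\<^sub>w cform_cnj \<omega>\<^sub>2) X Y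
           + complex_of_real c * (\<omega>\<^sub>2 \<and>\<^sub>w cform_cnj \<omega>\<^sub>1) X Y"
    and u: "cmod u = 1" and B: "B = 1 - complex_of_real c * u\<^sup>2"
  shows "lie_isomorphic br (normal_bracket (Re ((cnj u)\<^sup>2)) (Im ((cnj u)\<^sup>2)) c)"
proof -
  have uu: "u * cnj u = 1" "u \<noteq> 0"
    using u complex_norm_square[of u] by auto
  define t where "t X = u * \<omega>\<^sub>1 X" for X
  define z where "z X = cnj u * \<omega>\<^sub>3 X" for X
  have \<omega>1: "\<omega>\<^sub>1 X = cnj u * t X" for X
    using uu by (simp add: t_def mult.assoc[symmetric] mult.commute)
  have t: "t (br X Y) = 0" for X Y
    using d1[of X Y] by (simp add: t_def ce_d_def)
  have w: "\<omega>\<^sub>2 (br X Y) = t Y * cnj (t X) - t X * cnj (t Y)" for X Y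
  proof -
    have "- \<omega>\<^sub>2 (br X Y) = (u * cnj u) * (t X * cnj (t Y) - t Y * cnj (t X))"
      using d2[of X Y] unfolding ce_d_def wedge_def cform_cnj_def \<omega>1
      by (simp add: algebra_simps)
    then show ?thesis
      using uu by (simp add: minus_equation_iff[of "\<omega>\<^sub>2 (br X Y)"])
  qed
  have z: "- z (br X Y) =
      (cnj u)\<^sup>2 * (t X * \<omega>\<^sub>2 Y - t Y * \<omega>\<^sub>2 X)
      + ((cnj u)\<^sup>2 - c) * (t X * cnj (\<omega>\<^sub>2 Y) - t Y * cnj (\<omega>\<^sub>2 X))
      + c * (\<omega>\<^sub>2 X * cnj (t Y) - \<omega>\<^sub>2 Y * cnj (t X))" for X Y
  proof -
    have "- z (br X Y) = cnj u * (- \<omega>\<^sub>3 (br X Y))"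
      by (simp add: z_def)
    also have "\<dots> = cnj u * ((cnj u * t X * \<omega>\<^sub>2 Y - cnj u * t Y * \<omega>\<^sub>2 X)
      + (1 - c * u\<^sup>2) * (cnj u * t X * cnj (\<omega>\<^sub>2 Y) - cnj u * t Y * cnj (\<omega>\<^sub>2 X))
      + c * (\<omega>\<^sub>2 X * (u * cnj (t Y)) - \<omega>\<^sub>2 Y * (u * cnj (t X))))"
      using d3[of X Y] unfolding ce_d_def wedge_def cform_cnj_def \<omega>1 B
      by (simp add: mult.assoc)
    also have "\<dots> = (cnj u)\<^sup>2 * (t X * \<omega>\<^sub>2 Y - t Y * \<omega>\<^sub>2 X)
      + ((cnj u)\<^sup>2 - c) * (t X * cnj (\<omega>\<^sub>2 Y) - t Y * cnj (\<omega>\<^sub>2 X))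
      + c * (\<omega>\<^sub>2 X * cnj (t Y) - \<omega>\<^sub>2 Y * cnj (t X))"
      using uu(1) by algebra
    finally show ?thesis .
  qed
  define F where "F X = vec6 (Re (t X)) (Im (t X)) (Re (\<omega>\<^sub>2 X)) (Im (\<omega>\<^sub>2 X)) (Im (z X)) (Re (z X))" for X
  show ?thesis
  proof (rule lie_isomorphicI[where F = F])
    have "linear t" "linear z"
      using lin by (auto simp: t_def z_def linear_iff algebra_simps)
    with lin(2) show "linear F"
      by (auto simp: F_def linear_iff vec6_eq_iff)
    show "X = 0" if "F X = 0" for X
    proof (rule ker)
      have "t X = 0" "z X = 0" and "\<omega>\<^sub>2 X = 0"
        using that by (simp_all add: F_def vec6_eq_iff complex_eq_iff)
      then show "\<omega>\<^sub>1 X = 0" "\<omega>\<^sub>2 X = 0" "\<omega>\<^sub>3 X = 0"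
        using uu(2) by (simp_all add: t_def z_def)
    qed
    \<comment> \<open>Naming the two parts of \<open>(cnj u)\<^sup>2\<close> makes the comparison of
      coordinates a polynomial identity over the reals.\<close>
    define p q where "p = Re ((cnj u)\<^sup>2)" and "q = Im ((cnj u)\<^sup>2)"
    have "F (br X Y) = normal_bracket p q c (F X) (F Y)" for X Y
    proof -
      have "Re (- z (br X Y)) = Re (Complex p q * (t X * \<omega>\<^sub>2 Y - t Y * \<omega>\<^sub>2 X)
      + (Complex p q - c) * (t X * cnj (\<omega>\<^sub>2 Y) - t Y * cnj (\<omega>\<^sub>2 X))
      + c * (\<omega>\<^sub>2 X * cnj (t Y) - \<omega>\<^sub>2 Y * cnj (t X)))"
      "Im (- z (br X Y)) = Im (Complex p q * (t X * \<omega>\<^sub>2 Y - t Y * \<omega>\<^sub>2 X)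
      + (Complex p q - c) * (t X * cnj (\<omega>\<^sub>2 Y) - t Y * cnj (\<omega>\<^sub>2 X))
      + c * (\<omega>\<^sub>2 X * cnj (t Y) - \<omega>\<^sub>2 Y * cnj (t X)))"
        unfolding z p_def q_def by (simp_all only: complex_surj)
      then show ?thesis
        unfolding F_def vec6_eq_iff normal_bracket_eq vec6_nth w t
        by simp (intro conjI; algebra)
    qed
    then show "F (br X Y) = normal_bracket (Re ((cnj u)\<^sup>2)) (Im ((cnj u)\<^sup>2)) c (F X) (F Y)" for X Y
      by (simp only: p_def q_def)
  qed (use dim in simp)
qed

text \<open>With u a square root of (1 - B) / c, the parameters are \<alpha> = (1 - Re B) / c and
  \<beta> = Im B / c, so the condition on B decides which isomorphism of the normal form
  applies.\<close>

lemma isomorphic_cases: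
  fixes br :: "'g::real_vector \<Rightarrow> 'g \<Rightarrow> 'g" and B :: complex and c :: real
  assumes iso: "\<And>u. cmod u = 1 \<Longrightarrow> B = 1 - complex_of_real c * u\<^sup>2 \<Longrightarrow>
      lie_isomorphic br (normal_bracket (Re ((cnj u)\<^sup>2)) (Im ((cnj u)\<^sup>2)) c)"
    and c: "c = cmod (B - 1)" "cmod (B - 1) \<noteq> 0"
  shows "B = 0 \<Longrightarrow> lie_isomorphic br h10"
    and "B \<in> \<real> - {0, 1} \<Longrightarrow> lie_isomorphic br h11"
    and "Im B \<noteq> 0 \<Longrightarrow> lie_isomorphic br h12"
proof -
  have c0: "c > 0" using c by simp
  define u where "u = csqrt ((1 - B) / c)"
  have "cmod u = 1"
    using c c0 by (simp add: u_def norm_divide norm_minus_commute)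
  have u2: "u\<^sup>2 = (1 - B) / c"
    by (simp add: u_def)
  have B: "B = 1 - c * u\<^sup>2"
    using c0 by (simp add: u2)
  define \<alpha> \<beta> where "\<alpha> = Re ((cnj u)\<^sup>2)" and "\<beta> = Im ((cnj u)\<^sup>2)"
  have iso: "lie_isomorphic br (normal_bracket \<alpha> \<beta> c)"
    using iso[OF \<open>cmod u = 1\<close> B] by (simp add: \<alpha>_def \<beta>_def)
  have "\<alpha> = Re (cnj (u\<^sup>2))" "\<beta> = Im (cnj (u\<^sup>2))"
    by (simp_all only: \<alpha>_def \<beta>_def complex_cnj_power)
  then have \<alpha>: "\<alpha> = (1 - Re B) / c" and \<beta>: "\<beta> = Im B / c"
    unfolding u2 by (simp_all add: complex_cnj_divide)
  have c2: "c\<^sup>2 = (1 - Re B)\<^sup>2 + (Im B)\<^sup>2"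
    unfolding c(1) cmod_power2 by (simp add: power2_commute)
  have "\<alpha>\<^sup>2 + \<beta>\<^sup>2 = ((1 - Re B)\<^sup>2 + (Im B)\<^sup>2) / c\<^sup>2"
    by (simp add: \<alpha> \<beta> power_divide add_divide_distrib)
  then have \<alpha>\<beta>: "\<alpha>\<^sup>2 + \<beta>\<^sup>2 = 1"
    using c0 by (simp flip: c2)
  show "lie_isomorphic br h10" if "B = 0"
  proof -
    have "\<alpha> = 1" "\<beta> = 0" "c = 1"
      using that c by (simp_all add: \<alpha> \<beta>)
    with iso show ?thesis
      using normal_bracket_iso_h10 lie_isomorphic_trans by blast
  qed
  show "lie_isomorphic br h11" if B: "B \<in> \<real> - {0, 1}"
  proof -
    have im: "Im B = 0" and re: "Re B \<noteq> 0" "Re B \<noteq> 1"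
      using B by (auto simp: complex_is_Real_iff complex_eq_iff)
    have "\<beta> = 0" using im by (simp add: \<beta>)
    moreover have "\<alpha> \<noteq> 0" using re c0 by (simp add: \<alpha>)
    \<comment> \<open>Equality would give c^2 = 1 - Re B and c^2 = 1, hence Re B = 0.\<close>
    moreover have "\<alpha> \<noteq> c"
    proof
      assume "\<alpha> = c"
      with \<alpha> have "c = (1 - Re B) / c" by simp
      then have "c * c = 1 - Re B" using c0 by (simp add: field_simps)
      moreover have "c * c = 1"
        using \<alpha>\<beta> \<open>\<beta> = 0\<close> \<open>\<alpha> = c\<close> by (simp add: power2_eq_square)
      ultimately show False using re by simp
    qed
    ultimately show ?thesis
      using iso normal_bracket_iso_h11[of \<alpha> c] c0 lie_isomorphic_trans by auto
  qed
  show "lie_isomorphic br h12" if "Im B \<noteq> 0"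
    using that iso normal_bracket_iso_h12[OF \<alpha>\<beta>, of c] c0 lie_isomorphic_trans
    by (auto simp: \<beta>)
qed

section \<open>Complex structures on \<open>h10\<close>\<close>

text \<open>
  The matrix of \<open>J\<close> in the basis \<open>J v, v, J w, -w, -J y, y\<close>, whose signs are chosen to
  reproduce the bracket \<open>h10\<close>.
\<close>

definition J10 :: "real ^ 6 \<Rightarrow> real ^ 6" where
  "J10 X = vec6 (X $ 2) (- X $ 1) (- X $ 4) (X $ 3) (- X $ 6) (X $ 5)"

lemma complex_structure_h10_normal_form:
  assumes "complex_structure h10 J"
  obtains G where "lie_iso h10 h10 G" "\<And>X. J (G X) = G (J10 X)"
proof -
  have J: "linear J" "\<And>X. J (J X) = - X"
    and int: "\<And>X Y. h10 (J X) (J Y) = J (h10 (J X) Y) + J (h10 X (J Y)) + h10 X Y"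
    using assms by (auto simp: complex_structure_def)
  have Jr: "J (a *\<^sub>R X) = a *\<^sub>R J X" "J (X + Y) = J X + J Y" "J (- X) = - J X" "J 0 = 0"
    "J (X - Y) = J X - J Y" for a X Y
    using J(1) by (auto simp: linear_scale linear_add linear_neg linear_0 linear_diff)
  have no_eigen: "X = 0" if "J X = a *\<^sub>R X" for a X
  proof -
    have "- X = (a * a) *\<^sub>R X"
      using J(2)[of X] that Jr(1) by simp
    then have "(1 + a * a) *\<^sub>R X = 0"
      unfolding scaleR_left_distrib by (metis add.right_inverse scaleR_one)
    moreover have "1 + a * a \<noteq> 0"
      using zero_le_square[of a] by linarith
    ultimately show ?thesis by simp
  qed
  \<comment> \<open>Otherwise \<open>J\<close> preserves the hyperplane of vectors with first
    coordinate 0 and acts on the one-dimensional quotient by a real a with a^2 = -1.\<close>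
  have "\<exists>v. v $ 1 = 0 \<and> J v $ 1 \<noteq> 0"
  proof (rule ccontr)
    assume "\<not> ?thesis"
    then have *: "J v $ 1 = 0" if "v $ 1 = 0" for v
      using that by blast
    define a where "a = J (vec6 1 0 0 0 0 0) $ 1"
    have J1: "J X $ 1 = a * X $ 1" for X
      using *[of "X - X $ 1 *\<^sub>R vec6 1 0 0 0 0 0"] by (simp add: Jr a_def)
    have "- 1 = a * a"
      using J(2)[of "vec6 1 0 0 0 0 0"] J1[of "J (vec6 1 0 0 0 0 0)"] by (simp add: J1)
    then show False
      using zero_le_square[of a] by linarith
  qed
  then obtain v0 where v0: "v0 $ 1 = 0" "J v0 $ 1 \<noteq> 0" by blast
  define v where "v = (1 / J v0 $ 1) *\<^sub>R v0"
  define e where "e = J v"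
  have v1: "v $ 1 = 0" and e1: "e $ 1 = 1"
    using v0 by (simp_all add: v_def e_def Jr)
  have Je: "J e = - v" by (simp add: e_def J)
  \<comment> \<open>Integrability for \<open>v\<close> and \<open>h\<close>: the two brackets with
    \<open>v\<close> vanish because the hyperplane is an abelian ideal.\<close>
  have ad: "h10 e (J h) = J (h10 e h)" if "h $ 1 = 0" "J h $ 1 = 0" for h
  proof -
    have "h10 v h = 0" "h10 v (J h) = 0"
      using v1 that by (simp_all add: h10_eq vec6_eq_iff)
    then show ?thesis
      using int[of v h] by (simp add: e_def Jr)
  qed
  have ad1: "J (h10 e h) $ 1 = 0" if "h $ 1 = 0" "J h $ 1 = 0" for h
    using arg_cong[OF ad[OF that], of "\<lambda>X. X $ 1"] by (simp add: h10_eq[of e "J h"])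
  have ad2: "h10 e (h10 e h) = (h $ 2) *\<^sub>R vec6 0 0 0 0 0 1" if "h $ 1 = 0" for h
    using that e1 by (simp add: h10_eq vec6_eq_iff)
  \<comment> \<open>On such \<open>h\<close> the square of the adjoint map of \<open>e\<close>
    commutes with \<open>J\<close>, yet its values lie on the sixth axis; a nonzero value would be a
    real eigenvector of \<open>J\<close>.\<close>
  have h2: "h $ 2 = 0" if "h $ 1 = 0" "J h $ 1 = 0" for h
  proof (rule ccontr)
    assume "h $ 2 \<noteq> 0"
    have "h10 e (h10 e (J h)) = J (h10 e (h10 e h))"
      using ad[OF that] ad[of "h10 e h"] ad1[OF that] by (simp add: h10_eq)
    then have "(J h $ 2) *\<^sub>R vec6 0 0 0 0 0 1 = (h $ 2) *\<^sub>R J (vec6 0 0 0 0 0 1)"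
      using that by (simp add: ad2 Jr)
    then have "J (vec6 0 0 0 0 0 1) = (J h $ 2 / h $ 2) *\<^sub>R vec6 0 0 0 0 0 1"
      using \<open>h $ 2 \<noteq> 0\<close> by (simp add: vec6_eq_iff field_simps)
    then have "vec6 0 0 0 0 0 1 = 0"
      by (rule no_eigen)
    then show False
      by (simp add: vec6_eq_iff)
  qed
  \<comment> \<open>Subtracting a multiple of \<open>v\<close> moves any vector of the hyperplane
    into its \<open>J\<close>-invariant part, where the second coordinate is 0.\<close>
  have v2: "v $ 2 \<noteq> 0"
  proof
    assume "v $ 2 = 0"
    define x :: "real ^ 6" where "x = vec6 0 1 0 0 0 0"
    define h where "h = x - (J x $ 1) *\<^sub>R v"
    have "h $ 1 = 0" "J h $ 1 = 0"
      using v1 e1 by (simp_all add: h_def x_def Jr e_def)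
    then have "h $ 2 = 0" by (rule h2)
    with \<open>v $ 2 = 0\<close> show False by (simp add: h_def x_def)
  qed
  define w where "w = h10 e v"
  define y where "y = h10 e w"
  have y: "y = (v $ 2) *\<^sub>R vec6 0 0 0 0 0 1"
    using v1 by (simp add: y_def w_def ad2)
  have w1: "w $ 1 = 0" and w2: "w $ 2 = 0" and y1: "y $ 1 = 0" and ey: "h10 e y = 0"
    using e1 by (simp_all add: w_def y h10_eq vec6_eq_iff)
  have Jw1: "J w $ 1 = 0"
  proof -
    define h where "h = w - (J w $ 1) *\<^sub>R v"
    have "h $ 1 = 0" "J h $ 1 = 0"
      using w1 v1 e1 by (simp_all add: h_def Jr e_def)
    then have "h $ 2 = 0" by (rule h2)
    with w2 v2 show ?thesis by (simp add: h_def)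
  qed
  have eJw: "h10 e (J w) = J y"
    using ad[OF w1 Jw1] by (simp add: y_def)
  have Jy1: "J y $ 1 = 0"
    using ad1[OF w1 Jw1] by (simp add: y_def)
  have eJy: "h10 e (J y) = 0"
    using ad[OF y1 Jy1] by (simp add: ey Jr)
  have y0: "y \<noteq> 0" using v2 by (simp add: y vec6_eq_iff)
  have indep: "a = 0 \<and> b = 0" if "a *\<^sub>R y + b *\<^sub>R J y = 0" for a b
  proof (cases "b = 0")
    case False
    have "J y = (1 / b) *\<^sub>R (b *\<^sub>R J y)"
      using False by simp
    also have "b *\<^sub>R J y = - a *\<^sub>R y"
      using that by (simp add: eq_neg_iff_add_eq_0 add.commute)
    finally show ?thesis
      using no_eigen[of y "- a / b"] y0 by simp
  qed (use that y0 in auto)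
  define G where "G X = X $ 1 *\<^sub>R e + X $ 2 *\<^sub>R v + X $ 3 *\<^sub>R J w - X $ 4 *\<^sub>R w
      - X $ 5 *\<^sub>R J y + X $ 6 *\<^sub>R y" for X :: "real ^ 6"
  have linG: "linear G"
    by (auto simp: linear_iff G_def algebra_simps)
  have bil: "bilinear h10"
    using real_lie_algebra_h10 by (rule real_lie_algebra.bilinear)
  have G1: "G X $ 1 = X $ 1" for X
    by (simp add: G_def e1 v1 w1 y1 Jw1 Jy1)
  have adG: "h10 e (G X) = X $ 2 *\<^sub>R w + X $ 3 *\<^sub>R J y - X $ 4 *\<^sub>R y" for X
  proof -
    have "h10 e e = 0"
      using real_lie_algebra_h10 by (rule real_lie_algebra.alternating)
    then show ?thesis
      unfolding G_def bilinear_radd[OF bil] bilinear_rsub[OF bil] bilinear_rmul[OF bil]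
      by (simp add: eJw eJy ey flip: w_def y_def)
  qed
  \<comment> \<open>The hyperplane is abelian, so brackets are determined by the adjoint map of
    \<open>e\<close>.\<close>
  have brG: "h10 (G X) (G Y) = X $ 1 *\<^sub>R h10 e (G Y) - Y $ 1 *\<^sub>R h10 e (G X)" for X Y
    using e1 by (simp add: h10_eq[of "G X"] h10_eq[of e] vec6_eq_iff G1 algebra_simps)
  have "lie_iso h10 h10 G"
    unfolding lie_iso_def
  proof (intro conjI allI)
    show "G (h10 X Y) = h10 (G X) (G Y)" for X Y
      unfolding brG adG by (simp add: G_def h10_eq algebra_simps)
    show "bij G"
    proof (rule linear_injective_bij)
      fix X assume X: "G X = 0"
      \<comment> \<open>The coordinates of \<open>X\<close> are recovered in turn: the first
        directly, the second after applying \<open>J\<close>, the middle two after bracketing with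
        \<open>e\<close>, the rest by independence of \<open>y\<close> and
        \<open>J y\<close>.\<close>
      have X1: "X $ 1 = 0" using X G1[of X] by simp
      have "J (G X) $ 1 = X $ 2"
        using X1 v1 e1 w1 y1 Jw1 Jy1 by (simp add: G_def Jr J flip: e_def)
      then have X2: "X $ 2 = 0" using X by (simp add: Jr)
      have "h10 e (G X) = 0"
        using X by (simp add: bilinear_rzero[OF bil])
      then have "(- X $ 4) *\<^sub>R y + X $ 3 *\<^sub>R J y = 0"
        by (simp add: adG X2 algebra_simps)
      then have X34: "X $ 4 = 0" "X $ 3 = 0"
        using indep by fastforce+
      with X X1 X2 have "X $ 6 *\<^sub>R y + (- X $ 5) *\<^sub>R J y = 0"
        by (simp add: G_def)
      then have "X $ 6 = 0" "X $ 5 = 0"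
        using indep by fastforce+
      with X1 X2 X34 show "X = 0"
        by (simp add: vec6_eq_iff)
    qed (use linG in simp_all)
  qed (rule linG)
  moreover have "J (G X) = G (J10 X)" for X
    by (simp add: G_def J10_def Jr J Je algebra_simps flip: e_def)
  ultimately show ?thesis by (rule that)
qed

text \<open>Automorphisms \<open>G\<close> and \<open>G'\<close> conjugate both structures to
  \<open>J10\<close>, so \<open>G \<circ> inv G'\<close> intertwines them.\<close>

lemma equivalent_complex_structures_h10:
  assumes "complex_structure h10 J" "complex_structure h10 J'"
  shows "equivalent_complex_structures h10 J J'"
proof -
  obtain G where G: "lie_iso h10 h10 G" "\<And>X. J (G X) = G (J10 X)"
    using complex_structure_h10_normal_form[OF assms(1)] by blast
  obtain G' where G': "lie_iso h10 h10 G'" "\<And>X. J' (G' X) = G' (J10 X)"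
    using complex_structure_h10_normal_form[OF assms(2)] by blast
  define F where F: "F = G \<circ> inv G'"
  have bij: "bij G" "bij G'"
    using G G' by (auto simp: lie_iso_def)
  have inv: "lie_iso h10 h10 (inv G')"
    unfolding lie_iso_def
  proof (intro conjI allI)
    show "linear (inv G')"
      using G'(1) bij(2) by (auto simp: lie_iso_def inj_linear_imp_inv_linear bij_def)
    show "inv G' (h10 X Y) = h10 (inv G' X) (inv G' Y)" for X Y
      using G'(1) bij(2) unfolding lie_iso_def by (metis bij_inv_eq_iff)
  qed (use bij in \<open>simp add: bij_imp_bij_inv\<close>)
  have F_iso: "lie_iso h10 h10 F"
    unfolding F using inv G(1) by (rule lie_iso_comp)
  moreover have "J' = inv F \<circ> J \<circ> F"
  proof
    fix X
    have "F (J' X) = J (F X)"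
      using G(2) G'(2) bij(2) by (metis F comp_apply bij_inv_eq_iff)
    moreover have "bij F"
      using F_iso by (simp add: lie_iso_def)
    ultimately show "J' X = (inv F \<circ> J \<circ> F) X"
      by (metis comp_apply bij_inv_eq_iff)
  qed
  ultimately show ?thesis
    by (auto simp: equivalent_complex_structures_def)
qed

theorem proposition2p18:
  shows
    "(\<forall>(br :: 'g::real_vector \<Rightarrow> 'g \<Rightarrow> 'g) (J :: 'g \<Rightarrow> 'g)
        (\<omega>\<^sub>1 :: 'g \<Rightarrow> complex) (\<omega>\<^sub>2 :: 'g \<Rightarrow> complex) (\<omega>\<^sub>3 :: 'g \<Rightarrow> complex)
        (B :: complex) (c :: real).
        real_lie_algebra br \<and> dim (UNIV :: 'g set) = 6 \<and> step_nilpotent 3 br \<and>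
        complex_structure br J \<and> basis10 J \<omega>\<^sub>1 \<omega>\<^sub>2 \<omega>\<^sub>3 \<and>
        (\<forall>X Y. ce_d br \<omega>\<^sub>1 X Y = 0) \<and>
        (\<forall>X Y. ce_d br \<omega>\<^sub>2 X Y = (\<omega>\<^sub>1 \<and>\<^sub>w cform_cnj \<omega>\<^sub>1) X Y) \<and>
        (\<forall>X Y. ce_d br \<omega>\<^sub>3 X Y =
           (\<omega>\<^sub>1 \<and>\<^sub>w \<omega>\<^sub>2) X Y + B * (\<omega>\<^sub>1 \<and>\<^sub>w cform_cnj \<omega>\<^sub>2) X Y
           + complex_of_real c * (\<omega>\<^sub>2 \<and>\<^sub>w cform_cnj \<omega>\<^sub>1) X Y) \<and>
        c \<ge> 0 \<and> c = cmod (B - 1) \<and> cmod (B - 1) \<noteq> 0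
        \<longrightarrow>
        (lie_isomorphic br h10 \<longleftrightarrow> B = 0) \<and>
        (lie_isomorphic br h11 \<longleftrightarrow> B \<in> \<real> - {0, 1}) \<and>
        (lie_isomorphic br h12 \<longleftrightarrow> Im B \<noteq> 0)) \<and>
     (\<forall>J J'. complex_structure h10 J \<and> complex_structure h10 J' \<longrightarrow>
        equivalent_complex_structures h10 J J')"
proof (rule conjI; intro allI impI)
  fix br :: "'g \<Rightarrow> 'g \<Rightarrow> 'g" and J :: "'g \<Rightarrow> 'g" and \<omega>\<^sub>1 \<omega>\<^sub>2 \<omega>\<^sub>3 :: "'g \<Rightarrow> complex"
    and B :: complex and c :: real
  assume *: "real_lie_algebra br \<and> dim (UNIV :: 'g set) = 6 \<and> step_nilpotent 3 br \<and>
        complex_structure br J \<and> basis10 J \<omega>\<^sub>1 \<omega>\<^sub>2 \<omega>\<^sub>3 \<and>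
        (\<forall>X Y. ce_d br \<omega>\<^sub>1 X Y = 0) \<and>
        (\<forall>X Y. ce_d br \<omega>\<^sub>2 X Y = (\<omega>\<^sub>1 \<and>\<^sub>w cform_cnj \<omega>\<^sub>1) X Y) \<and>
        (\<forall>X Y. ce_d br \<omega>\<^sub>3 X Y =
           (\<omega>\<^sub>1 \<and>\<^sub>w \<omega>\<^sub>2) X Y + B * (\<omega>\<^sub>1 \<and>\<^sub>w cform_cnj \<omega>\<^sub>2) X Y
           + complex_of_real c * (\<omega>\<^sub>2 \<and>\<^sub>w cform_cnj \<omega>\<^sub>1) X Y) \<and>
        c \<ge> 0 \<and> c = cmod (B - 1) \<and> cmod (B - 1) \<noteq> 0"
  then have b: "basis10 J \<omega>\<^sub>1 \<omega>\<^sub>2 \<omega>\<^sub>3" and J: "linear J" "\<And>X. J (J X) = - X"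
    and c: "c = cmod (B - 1)" "cmod (B - 1) \<noteq> 0"
    by (auto simp: complex_structure_def)
  have "lie_isomorphic br (normal_bracket (Re ((cnj u)\<^sup>2)) (Im ((cnj u)\<^sup>2)) c)"
    if "cmod u = 1" "B = 1 - complex_of_real c * u\<^sup>2" for u
    by (rule isomorphic_normal_bracket[of \<omega>\<^sub>1 \<omega>\<^sub>2 \<omega>\<^sub>3])
       (use * that basis10_mem[OF b] basis10_ker[OF b J] in auto)
  note iso = isomorphic_cases[OF this c]
  \<comment> \<open>\<open>iso\<close> goes only from B to the model. The converses follow because
    the models are pairwise non-isomorphic and the three conditions cover every B other than
    1.\<close>
  have exclusive: "\<not> (lie_isomorphic br h10 \<and> lie_isomorphic br h11)"
    "\<not> (lie_isomorphic br h10 \<and> lie_isomorphic br h12)"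
    "\<not> (lie_isomorphic br h11 \<and> lie_isomorphic br h12)"
    using not_isomorphic_h10_h11 not_isomorphic_h10_h12 not_isomorphic_h11_h12
      lie_isomorphic_sym lie_isomorphic_trans by blast+
  have "B = 0 \<or> B \<in> \<real> - {0, 1} \<or> Im B \<noteq> 0"
    using c by (auto simp: complex_is_Real_iff)
  moreover have "\<not> (B = 0 \<and> Im B \<noteq> 0)" "\<not> (B \<in> \<real> - {0, 1} \<and> Im B \<noteq> 0)"
    by (auto simp: complex_is_Real_iff)
  ultimately show "(lie_isomorphic br h10 \<longleftrightarrow> B = 0) \<and>
        (lie_isomorphic br h11 \<longleftrightarrow> B \<in> \<real> - {0, 1}) \<and>
        (lie_isomorphic br h12 \<longleftrightarrow> Im B \<noteq> 0)"
    using iso exclusive by blast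
next
  fix J J'
  assume "complex_structure h10 J \<and> complex_structure h10 J'"
  then show "equivalent_complex_structures h10 J J'"
    using equivalent_complex_structures_h10 by blast
qed

end
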